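(* Let $k$ be a positive integer and let $\mathcal{F}$ be a maximal intersecting family of $k$-sets (an $MIF(k)$). Let $\alpha\neq\beta$ be two points of $\mathcal{F}$ such that no block of $\mathcal{F}$ contains both $\alpha$ and $\beta$. Let $\mathcal{G}=\{B\in\mathcal{F}:\alpha\notin B,\ \beta\notin B\}$ and define $$\mathcal{F}[\beta\mapsto\alpha]:=\mathcal{G}\cup\{T\cup\{\alpha\}: T\in\mathcal{G}^{\top}\}.$$ Then $\mathcal{F}[\beta\mapsto\alpha]$ is an $MIF(k)$ whose point set is $P_{\mathcal{F}}\setminus\{\beta\}$.
   Context: A family is a family of finite sets; its members are blocks, the elements of blocks are its points, and the point set $P_{\mathcal{F}}$ is the union of all blocks. A blocking set of $\mathcal{F}$ is a set meeting every block of $\mathcal{F}$. If $\mathcal{F}$ has a finite blocking set, a transversal of $\mathcal{F}$ is a blocking set of minimum possible size, and $\mathcal{F}^{\top}$ denotes the family of all transversals of $\mathcal{F}$. A family $\mathcal{F}$ is a maximal intersecting family ($MIF$) if it has a finite blocking set and $\mathcal{F}=\mathcal{F}^{\top}$; it is an $MIF(k)$ if moreover all its blocks have size $k$. (Equivalently, an $MIF(k)$ is a family of $k$-sets, any two of which intersect, such that no $k$-set outside the family meets all of its blocks.) *)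

theory Defs
  imports Main
begin

definition points :: "'a set set \<Rightarrow> 'a set" where
  "points F = \<Union>F"

definition blocking_set :: "'a set set \<Rightarrow> 'a set \<Rightarrow> bool" where
  "blocking_set F S \<longleftrightarrow> (\<forall>B\<in>F. S \<inter> B \<noteq> {})"

definition has_finite_blocking_set :: "'a set set \<Rightarrow> bool" where
  "has_finite_blocking_set F \<longleftrightarrow> (\<exists>S. finite S \<and> blocking_set F S)"

text \<open>Since \<open>card\<close> is \<open>0\<close> on infinite sets, minimality is taken among finite blocking
  sets; if there are none, \<open>transversals F\<close> is empty.\<close>

definition transversals :: "'a set set \<Rightarrow> 'a set set" where
  "transversals F = {T. finite T \<and> blocking_set F T \<and>
     (\<forall>S. finite S \<and> blocking_set F S \<longrightarrow> card T \<le> card S)}"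

definition MIF :: "'a set set \<Rightarrow> bool" where
  "MIF F \<longleftrightarrow> (\<forall>B\<in>F. finite B) \<and> has_finite_blocking_set F \<and> F = transversals F"

definition MIF_k :: "nat \<Rightarrow> 'a set set \<Rightarrow> bool" where
  "MIF_k k F \<longleftrightarrow> MIF F \<and> (\<forall>B\<in>F. card B = k)"

definition avoiding :: "'a set set \<Rightarrow> 'a \<Rightarrow> 'a \<Rightarrow> 'a set set" where
  "avoiding F \<alpha> \<beta> = {B \<in> F. \<alpha> \<notin> B \<and> \<beta> \<notin> B}"

text \<open>\<open>merge F \<beta> \<alpha>\<close> is the family \<open>F[\<beta> \<mapsto> \<alpha>]\<close>.\<close>

definition merge :: "'a set set \<Rightarrow> 'a \<Rightarrow> 'a \<Rightarrow> 'a set set" where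
  "merge F \<beta> \<alpha> =
     avoiding F \<alpha> \<beta> \<union> {T \<union> {\<alpha>} |T. T \<in> transversals (avoiding F \<alpha> \<beta>)}"

end

theory Submission
  imports Defs
begin

text \<open>
  The family \<open>G\<close> of blocks avoiding \<open>\<alpha>\<close> and \<open>\<beta>\<close> has blocking number \<open>k - 1\<close>: deleting
  \<open>\<alpha>\<close> (or \<open>\<beta>\<close>) from a block through it leaves a blocking set of \<open>G\<close>, while a blocking set of
  \<open>G\<close> with at most \<open>k - 2\<close> points, enlarged by \<open>\<alpha>\<close> and \<open>\<beta>\<close>, would be a block through both.
  Let \<open>C\<close> block the merged family with at most \<open>k\<close> points. If \<open>\<alpha> \<in> C\<close>, then \<open>C - {\<alpha>}\<close>
  is a transversal of \<open>G\<close>. If \<open>\<alpha> \<notin> C\<close>, then \<open>C\<close> meets every transversal of \<open>G\<close>; these include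
  all truncated blocks, so \<open>C - {\<beta>}\<close> blocks \<open>F\<close> and hence \<open>C = C - {\<beta>}\<close> is a block of \<open>G\<close>.
\<close>

lemma transversals_nonempty:
  assumes "has_finite_blocking_set F"
  shows "transversals F \<noteq> {}"
proof -
  let ?P = "\<lambda>S. finite S \<and> blocking_set F S"
  obtain S where "?P S"
    using assms unfolding has_finite_blocking_set_def by blast
  then obtain T where "?P T" "\<forall>S. ?P S \<longrightarrow> card T \<le> card S"
    using ex_has_least_nat[of ?P S card] by blast
  then show ?thesis
    unfolding transversals_def by blast
qed

text \<open>A point of \<open>T\<close> outside all blocks could be deleted, leaving a smaller
  blocking set.\<close>

lemma transversal_subset_points:
  assumes "T \<in> transversals F"
  shows "T \<subseteq> points F"
proof
  fix x assume x: "x \<in> T"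
  have T: "finite T" "blocking_set F T"
    and min: "\<And>S. finite S \<Longrightarrow> blocking_set F S \<Longrightarrow> card T \<le> card S"
    using assms unfolding transversals_def by auto
  have "\<not> blocking_set F (T - {x})"
    using min[of "T - {x}"] T(1) card_Diff1_less[OF T(1) x] by auto
  then show "x \<in> points F"
    using T(2) unfolding blocking_set_def points_def by blast
qed

text \<open>Trades minimality for a closure condition that can be checked set by set. The bound
  \<open>card C \<le> k\<close>, rather than equality, also encodes that no blocking set has fewer
  than \<open>k\<close> points: it would be a block of the wrong size.\<close>

lemma MIF_k_iff:
  "MIF_k k F \<longleftrightarrow> F \<noteq> {} \<and> (\<forall>B\<in>F. finite B \<and> card B = k \<and> blocking_set F B)
     \<and> (\<forall>C. finite C \<and> blocking_set F C \<and> card C \<le> k \<longrightarrow> C \<in> F)"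
  (is "?L \<longleftrightarrow> ?R")
proof
  assume ?L
  then have F: "F = transversals F" "has_finite_blocking_set F" "\<forall>B\<in>F. card B = k"
    unfolding MIF_k_def MIF_def by auto
  then obtain B where B: "B \<in> F"
    using transversals_nonempty by blast
  have blocks: "\<forall>B\<in>F. finite B \<and> blocking_set F B
      \<and> (\<forall>S. finite S \<and> blocking_set F S \<longrightarrow> card B \<le> card S)"
    using F(1) unfolding transversals_def by blast
  have "C \<in> F" if "finite C" "blocking_set F C" "card C \<le> k" for C
  proof -
    have "\<forall>S. finite S \<and> blocking_set F S \<longrightarrow> card C \<le> card S"
      using blocks B F(3) that(3) by (metis order_trans)
    then have "C \<in> transversals F"
      using that unfolding transversals_def by blast
    then show ?thesis using F(1) by simp
  qed
  then show ?R using blocks B F(3) by blast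
next
  assume R: ?R
  then obtain B where B: "B \<in> F" by blast
  have min: "k \<le> card S" if "finite S" "blocking_set F S" for S
    using R that by (metis nat_le_linear)
  have "F = transversals F"
  proof
    show "F \<subseteq> transversals F"
    proof
      fix B assume "B \<in> F"
      then have "finite B" "card B = k" "blocking_set F B" using R by blast+
      then show "B \<in> transversals F"
        using min unfolding transversals_def by simp
    qed
    show "transversals F \<subseteq> F"
    proof
      fix T assume "T \<in> transversals F"
      then have T: "finite T" "blocking_set F T"
        and le: "\<And>S. finite S \<Longrightarrow> blocking_set F S \<Longrightarrow> card T \<le> card S"
        unfolding transversals_def by auto
      have "card T \<le> k" using le[of B] R B by metis
      then show "T \<in> F" using R T by blast
    qed
  qed
  then show ?L
    using R B unfolding MIF_k_def MIF_def has_finite_blocking_set_def by blast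
qed

theorem theorem2p6:
  fixes F :: "'a set set" and k :: nat and \<alpha> \<beta> :: 'a
  assumes "k > 0"
    and "MIF_k k F"
    and "\<alpha> \<in> points F" and "\<beta> \<in> points F" and "\<alpha> \<noteq> \<beta>"
    and "\<not> (\<exists>B\<in>F. \<alpha> \<in> B \<and> \<beta> \<in> B)"
  shows "MIF_k k (merge F \<beta> \<alpha>) \<and> points (merge F \<beta> \<alpha>) = points F - {\<beta>}"
proof -
  define G where "G = avoiding F \<alpha> \<beta>"
  define H where "H = merge F \<beta> \<alpha>"
  have block: "finite B" "card B = k" "blocking_set F B" if "B \<in> F" for B
    using assms(2) that unfolding MIF_k_iff by blast+
  have maximal: "C \<in> F" if "finite C" "blocking_set F C" "card C \<le> k" for C
    using assms(2) that unfolding MIF_k_iff by blast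
  have G_iff: "B \<in> G \<longleftrightarrow> B \<in> F \<and> \<alpha> \<notin> B \<and> \<beta> \<notin> B" for B
    unfolding G_def avoiding_def by auto
  have H_eq: "H = G \<union> {insert \<alpha> T |T. T \<in> transversals G}"
    unfolding H_def G_def merge_def by auto

  have G_lower: "k - 1 \<le> card S" if S: "finite S" "blocking_set G S" for S
  proof (rule ccontr)
    \<comment> \<open>Even with truncated subtraction this gives \<open>card S + 2 \<le> k\<close>,
      which leaves room for both extra points.\<close>
    assume "\<not> k - 1 \<le> card S"
    moreover have "card (insert \<alpha> (insert \<beta> S)) \<le> Suc (Suc (card S))"
      using S(1) by (simp add: card_insert_if)
    moreover have "blocking_set F (insert \<alpha> (insert \<beta> S))"
      using S(2) G_iff unfolding blocking_set_def by blast
    ultimately have "insert \<alpha> (insert \<beta> S) \<in> F"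
      using S(1) by (intro maximal) auto
    then show False using assms(6) by blast
  qed
  have G_transI: "S \<in> transversals G" if "finite S" "blocking_set G S" "card S \<le> k - 1" for S
    using that G_lower order_trans unfolding transversals_def by blast
  \<comment> \<open>The point \<open>x\<close> lies in no block of \<open>G\<close>, so deleting it
    from \<open>B\<close> destroys no intersection with such a block.\<close>
  have truncated: "B - {x} \<in> transversals G" if "B \<in> F" "x \<in> B" "x = \<alpha> \<or> x = \<beta>" for B x
  proof (rule G_transI)
    show "finite (B - {x})" "card (B - {x}) \<le> k - 1"
      using block[OF that(1)] that(2) by auto
    show "blocking_set G (B - {x})"
      using block(3)[OF that(1)] that(3) G_iff unfolding blocking_set_def by blast
  qed
  obtain A where A: "A \<in> F" "\<alpha> \<in> A"
    using assms(3) unfolding points_def by blast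
  have trans: "finite T" "blocking_set G T" "card T = k - 1" "\<alpha> \<notin> T" "\<beta> \<notin> T"
    "T \<subseteq> points G" if T: "T \<in> transversals G" for T
  proof -
    show fin: "finite T" and blk: "blocking_set G T"
      using T unfolding transversals_def by auto
    \<comment> \<open>This one truncated block fixes the size of all transversals of
      \<open>G\<close>.\<close>
    have "A - {\<alpha>} \<in> transversals G" using truncated A by blast
    then have "card T \<le> card (A - {\<alpha>})"
      using T unfolding transversals_def by blast
    also have "\<dots> = k - 1" using block[OF A(1)] A(2) by simp
    finally show "card T = k - 1" using G_lower[OF fin blk] by simp
    show "T \<subseteq> points G" using transversal_subset_points[OF T] .
    then show "\<alpha> \<notin> T" "\<beta> \<notin> T" using G_iff unfolding points_def by auto
  qed

  have "MIF_k k H"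
    unfolding MIF_k_iff
  proof (intro conjI ballI allI impI)
    show "H \<noteq> {}"
      using truncated[of A \<alpha>] A unfolding H_eq by blast
  next
    fix B assume B: "B \<in> H"
    show "finite B" "card B = k"
      using B trans assms(1) block G_iff unfolding H_eq by auto
    have GG: "\<And>B B'. B \<in> G \<Longrightarrow> B' \<in> G \<Longrightarrow> B \<inter> B' \<noteq> {}"
      using block(3) G_iff unfolding blocking_set_def by simp
    have TG: "\<And>T B. T \<in> transversals G \<Longrightarrow> B \<in> G \<Longrightarrow> T \<inter> B \<noteq> {}"
      using trans(2) unfolding blocking_set_def by simp
    \<comment> \<open>Two blocks of \<open>G\<close> meet by \<open>GG\<close>, a block of
      \<open>G\<close> and an enlarged transversal by \<open>TG\<close>, and two enlarged
      transversals share \<alpha>.\<close>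
    have "B \<inter> B' \<noteq> {}" if "B' \<in> H" for B'
      using B that unfolding H_eq
      by (elim UnE CollectE exE conjE; use GG[of B B'] TG in fast)
    then show "blocking_set H B" unfolding blocking_set_def by blast
  next
    fix C assume C: "finite C \<and> blocking_set H C \<and> card C \<le> k"
    have blkG: "blocking_set G C"
      using C unfolding H_eq blocking_set_def by blast
    show "C \<in> H"
    proof (cases "\<alpha> \<in> C")
      case True
      have "C - {\<alpha>} \<in> transversals G"
      proof (rule G_transI)
        show "blocking_set G (C - {\<alpha>})"
          using blkG G_iff unfolding blocking_set_def by blast
      qed (use C True in auto)
      moreover have "C = insert \<alpha> (C - {\<alpha>})" using True by auto
      ultimately show ?thesis unfolding H_eq by blast
    next
      case False
      have meets: "(C - {\<beta>}) \<inter> T \<noteq> {}" if "T \<in> transversals G" for T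
      proof -
        have "C \<inter> insert \<alpha> T \<noteq> {}"
          using C that unfolding H_eq blocking_set_def by blast
        \<comment> \<open>The common point is not \<alpha>, as \<open>C\<close> omits \<alpha>; so
          it lies in \<open>T\<close> and differs from \<beta>.\<close>
        then show ?thesis using False trans(5)[OF that] by auto
      qed
      have blkF: "blocking_set F (C - {\<beta>})"
        unfolding blocking_set_def
      proof
        fix B assume B: "B \<in> F"
        show "(C - {\<beta>}) \<inter> B \<noteq> {}"
        proof (cases "B \<in> G")
          case True
          then show ?thesis using blkG G_iff unfolding blocking_set_def by blast
        next
          case False
          then obtain x where "x \<in> B" "x = \<alpha> \<or> x = \<beta>" using B G_iff by blast
          then show ?thesis using meets[OF truncated[OF B]] by blast
        qed
      qed
      \<comment> \<open>As a block, \<open>C - {\<beta>}\<close> has \<open>k\<close> points, while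
        \<open>C\<close> has at most \<open>k\<close>; so the deletion removed nothing.\<close>
      have le: "card (C - {\<beta>}) \<le> card C" using C by (simp add: card_Diff1_le)
      then have inF: "C - {\<beta>} \<in> F"
        using C blkF by (intro maximal) auto
      then have "card (C - {\<beta>}) = card C" using block(2) C le by force
      then have "\<beta> \<notin> C" using C card_Diff1_less[of C \<beta>] by auto
      then show ?thesis using inF False G_iff unfolding H_eq by simp
    qed
  qed
  moreover have "points H = points F - {\<beta>}"
  proof
    have "points G \<subseteq> points F - {\<beta>}"
      using G_iff unfolding points_def by blast
    \<comment> \<open>Transversals of \<open>G\<close> add no points beyond those of
      \<open>G\<close>; the only further point is \<alpha>.\<close>
    then show "points H \<subseteq> points F - {\<beta>}"
      using trans(6) assms(3,5) unfolding H_eq points_def by blast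
    show "points F - {\<beta>} \<subseteq> points H"
    proof
      fix x assume "x \<in> points F - {\<beta>}"
      then obtain B where B: "B \<in> F" "x \<in> B" "x \<noteq> \<beta>"
        unfolding points_def by blast
      show "x \<in> points H"
      proof (cases "B \<in> G")
        case True
        then show ?thesis using B(2) unfolding H_eq points_def by blast
      next
        case False
        then obtain y where y: "y \<in> B" "y = \<alpha> \<or> y = \<beta>" using B(1) G_iff by blast
        then have "insert \<alpha> (B - {y}) \<in> H"
          using truncated[OF B(1) y] unfolding H_eq by blast
        \<comment> \<open>If \<open>x\<close> is the deleted point \<open>y\<close>, then it is
          \<alpha>, since \<open>x\<close> is not \<beta>, and \<alpha> is put back.\<close>
        moreover have "x \<in> insert \<alpha> (B - {y})" using B y(2) by blast
        ultimately show ?thesis unfolding points_def by blast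
      qed
    qed
  qed
  ultimately show ?thesis unfolding H_def by blast
qed

end
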